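(* Let $\theta_1$ be the root of the polynomial $p_1^{D}$ defined by $$\{p_1^{D}\}=\arg\min_{p\in\mathbb{P}_1(0)}\sum_{i\in\bar\pi_k^a}\frac{\eta_i^2}{\lambda_i}p(\lambda_i)^2,$$ and let $F_{\theta_1}=I_n+\sum_{i\in\pi_k^a}\big(\frac{\theta_1}{\lambda_i}-1\big)s_is_i^\top$. Then $$\|x^\ast-\hat x_1(F_{\theta_1})\|_A^2=\|x^\ast-x_1^{D}\|_A^2,$$ where $x_1^{D}=\sum_{i\in\pi_k^a}\frac1{\lambda_i}s_is_i^\top b+Pz_1$ is the first deflated CG iterate.
   Context: $A\in\mathbb{R}^{n\times n}$ is symmetric positive definite with spectral decomposition $A=S\Lambda S^\top$, $\Lambda=\mathrm{diag}(\lambda_1,\dots,\lambda_n)$, $\lambda_1\ge\dots\ge\lambda_n>0$, $S=[s_1\ \cdots\ s_n]$ orthogonal. $b\in\mathbb{R}^n$, $x^\ast=A^{-1}b$, $x_0\in\mathbb{R}^n$ is an initial guess, $r_0=b-Ax_0$, $\eta_i=s_i^\top r_0$. $\|x\|_A=\sqrt{x^\top A x}$. $\mathbb{P}_1(0)$ is the set of real polynomials of degree at most $1$ with value $1$ at $0$. $k$ is an integer with $1<k<n$. A bar over a subset of $\{1,\dots,n\}$ denotes its complement. Exact arithmetic is assumed. $j_0\in\arg\min_{1\le j\le k+1}\lambda_j/\lambda_{n-k+j-1}$, and $\pi_k^a\subset\{1,\dots,n\}$ is the set of $k$ indices with $\bar\pi_k^a=\{j_0,j_0+1,\dots,n-k+j_0-1\}$.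 Feasible preconditioner: $F=I_n+SDS^\top$ with $D=\mathrm{diag}(d_1,\dots,d_n)$ real, $I_n+D$ positive definite and $\mathrm{rank}(D)\le k$. $\mathbf{PCG}(F)$ is the preconditioned conjugate gradient method for $Ax=b$ with preconditioner $F$: $\hat x_0=x_0$, $\hat r_0=b-A\hat x_0$, $z_0=F\hat r_0$, $\hat\rho_0=\hat r_0^\top z_0$, $\hat p_0=z_0$, and for $\ell=0,1,\dots$: $\hat q_\ell=A\hat p_\ell$, $\hat\alpha_\ell=\hat\rho_\ell/(\hat q_\ell^\top\hat p_\ell)$, $\hat x_{\ell+1}=\hat x_\ell+\hat\alpha_\ell\hat p_\ell$, $\hat r_{\ell+1}=\hat r_\ell-\hat\alpha_\ell\hat q_\ell$, $z_{\ell+1}=F\hat r_{\ell+1}$, $\hat\rho_{\ell+1}=\hat r_{\ell+1}^\top z_{\ell+1}$, $\hat\beta_{\ell+1}=\hat\rho_{\ell+1}/\hat\rho_\ell$, $\hat p_{\ell+1}=z_{\ell+1}+\hat\beta_{\ell+1}\hat p_\ell$; it stops once the solution is reached. $\hat x_\ell(F)$ denotes its $\ell$-th iterate. The same recurrences with $F=I_n$ define CG, also for a consistent system with symmetric positive semidefinite matrix. In the definition of $x_1^{D}$: $P=I_n-\sum_{i\in\pi_k^a}s_is_i^\top$, and $z_1$ is the first iterate of CG applied to the consistent system $PAz=Pb$ starting from $z_0=x_0$ (not to be confused with the $z_\ell$ in the PCG recurrences). Standing assumption: an integer $\ell\ge1$ is fixed and, for every feasible $F$, $\mathbf{PCG}(F)$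 has not reached the solution at iteration $\ell$ (the iterates up to $\ell$ are defined and $\hat x_j(F)\ne x^\ast$ for $j\le\ell$). *)

theory Defs
  imports "HOL-Analysis.Analysis" "HOL-Computational_Algebra.Polynomial"
begin

definition diag_matrix :: "real^'n \<Rightarrow> real^'n^'n" where
  "diag_matrix d = (\<chi> i j. if i = j then d $ i else 0)"

definition outer :: "real^'n \<Rightarrow> real^'n \<Rightarrow> real^'n^'n" where
  "outer u v = (\<chi> i j. u $ i * v $ j)"

definition spd :: "real^'n^'n \<Rightarrow> bool" where
  "spd M \<longleftrightarrow> transpose M = M \<and> (\<forall>x. x \<noteq> 0 \<longrightarrow> 0 < x \<bullet> (M *v x))"

definition energy_norm :: "real^'n^'n \<Rightarrow> real^'n \<Rightarrow> real" where
  "energy_norm A x = sqrt (x \<bullet> (A *v x))"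

definition P1_zero :: "real poly set" where
  "P1_zero = {p. degree p \<le> 1 \<and> poly p 0 = 1}"

definition feasible :: "real^'n^'n \<Rightarrow> nat \<Rightarrow> real^'n^'n \<Rightarrow> bool" where
  "feasible S k F \<longleftrightarrow>
     (\<exists>d. F = mat 1 + S ** diag_matrix d ** transpose S
        \<and> spd (mat 1 + diag_matrix d) \<and> rank (diag_matrix d) \<le> k)"

(* The state after l steps is (x_l, r_l, p_l). The recursion is total: once r_l = 0, the
   convention a / 0 = 0 makes all later steps leave x_l unchanged, which represents stopping.
   That no division by zero occurs before that is expressed by pcg_defined. *)
primrec pcg_state ::
  "real^'n^'n \<Rightarrow> real^'n^'n \<Rightarrow> real^'n \<Rightarrow> real^'n \<Rightarrow> nat \<Rightarrow> (real^'n) \<times> (real^'n) \<times> (real^'n)"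
where
  "pcg_state A F b x0 0 =
     (let r = b - A *v x0; z = F *v r in (x0, r, z))"
| "pcg_state A F b x0 (Suc l) =
     (case pcg_state A F b x0 l of (x, r, p) \<Rightarrow>
        let \<rho> = r \<bullet> (F *v r);
            q = A *v p;
            \<alpha> = \<rho> / (q \<bullet> p);
            x' = x + \<alpha> *\<^sub>R p;
            r' = r - \<alpha> *\<^sub>R q;
            z' = F *v r';
            \<rho>' = r' \<bullet> z';
            \<beta>' = \<rho>' / \<rho>
        in (x', r', z' + \<beta>' *\<^sub>R p))"

definition pcg_iterate :: "real^'n^'n \<Rightarrow> real^'n^'n \<Rightarrow> real^'n \<Rightarrow> real^'n \<Rightarrow> nat \<Rightarrow> real^'n" where
  "pcg_iterate A F b x0 l = fst (pcg_state A F b x0 l)"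

definition cg_iterate :: "real^'n^'n \<Rightarrow> real^'n \<Rightarrow> real^'n \<Rightarrow> nat \<Rightarrow> real^'n" where
  "cg_iterate A b x0 l = pcg_iterate A (mat 1) b x0 l"

(* Every divisor used in computing x_l is nonzero: the alpha_j with j < l divide by
   q_j . p_j, and the beta_(j+1) with j + 1 < l divide by rho_j. *)
definition pcg_defined :: "real^'n^'n \<Rightarrow> real^'n^'n \<Rightarrow> real^'n \<Rightarrow> real^'n \<Rightarrow> nat \<Rightarrow> bool" where
  "pcg_defined A F b x0 l \<longleftrightarrow>
     (\<forall>j<l. case pcg_state A F b x0 j of (x, r, p) \<Rightarrow>
        (A *v p) \<bullet> p \<noteq> 0 \<and> (j + 1 < l \<longrightarrow> r \<bullet> (F *v r) \<noteq> 0))"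

end

theory Submission
  imports Defs
begin

text \<open>
  The two iterates agree as vectors, so the equality of their energy-norm errors is immediate.
  Let \<open>\<theta>\<close> be the root in question and split the initial residual along the eigenvectors:
  \<open>r0 = y + g\<close>, where \<open>y\<close> lives on the indices outside the preconditioned set and \<open>g\<close>
  inside it.

  Minimising \<open>\<Sum> \<eta>\<^sub>i\<^sup>2 / \<lambda>\<^sub>i * (1 - a * \<lambda>\<^sub>i)\<^sup>2\<close> over \<open>a\<close>,
  the sums ranging over the indices outside the preconditioned set, gives
  \<open>a = \<Sum> \<eta>\<^sub>i\<^sup>2 / \<Sum> \<eta>\<^sub>i\<^sup>2 * \<lambda>\<^sub>i = (y \<bullet> y) / (y \<bullet> A y)\<close>
  (\<open>weighted_square_P1_zero_argmin\<close>). This is the step length of one step of steepest descent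
  with residual \<open>y\<close>, and its inverse, the Rayleigh quotient of \<open>y\<close>, is \<open>\<theta>\<close>. The
  deflated system has \<open>y\<close> as its initial residual, so its first CG step adds
  \<open>y / \<theta>\<close>; the deflated components are solved exactly, which adds the vector \<open>v\<close> with
  \<open>A v = g\<close>.

  The preconditioner replaces the eigenvalues in the preconditioned set by the single value
  \<open>\<theta>\<close>, so its search direction is \<open>y + \<theta> v\<close>. Since \<open>\<theta>\<close> is already the Rayleigh
  quotient of \<open>y\<close>, adding components with this eigenvalue leaves the step length at
  \<open>1 / \<theta>\<close> (\<open>split_residual_step_length\<close>), and the PCG step adds the same vector
  \<open>y / \<theta> + v\<close>.

  All this needs \<open>y \<noteq> 0\<close>, without which the minimiser is not unique. If \<open>y\<close> vanished, the
  feasible preconditioner with \<open>\<theta> = 1\<close> would act as the inverse of \<open>A\<close> on \<open>r0\<close> and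
  PCG would be finished after one step (\<open>pcg_iterate_1_exact\<close>), against the assumption that no
  feasible preconditioner has reached the solution.
\<close>

section \<open>Rank-one sums and feasible preconditioners\<close>

lemma outer_mult_vec: "outer u v *v x = (v \<bullet> x) *\<^sub>R (u :: real^'n)"
  by (simp add: vec_eq_iff matrix_vector_mult_def outer_def inner_vec_def
      sum_distrib_right sum_distrib_left mult.assoc mult.commute mult.left_commute)

lemma sum_matrix_mult_vec: "(\<Sum>i\<in>I. M i) *v x = (\<Sum>i\<in>I. M i *v (x :: real^'n))"
  by (induction I rule: infinite_finite_induct) (simp_all add: matrix_vector_mult_add_rdistrib)

lemma sum_scaled_outer_mult_vec:
  "(\<Sum>i\<in>I. c i *\<^sub>R outer (s i) (s i)) *v x = (\<Sum>i\<in>I. (c i * (s i \<bullet> x)) *\<^sub>R (s i :: real^'n))"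
  by (simp add: sum_matrix_mult_vec scaleR_matrix_vector_assoc [symmetric] outer_mult_vec)

lemma diag_congruence_eq_sum_outer:
  fixes S :: "real^'n^'n"
  shows "S ** diag_matrix d ** transpose S
    = (\<Sum>j\<in>UNIV. d $ j *\<^sub>R outer (column j S) (column j S))"
  by (simp add: vec_eq_iff matrix_matrix_mult_def diag_matrix_def transpose_def outer_def column_def
      if_distrib [of "\<lambda>x. _ * x"] sum.delta mult_ac cong: if_cong)

text \<open>
  The columns with a zero diagonal entry vanish, so the others span the column space.
\<close>

lemma rank_diag_matrix_le: "rank (diag_matrix (d :: real^'n)) \<le> card {i. d $ i \<noteq> 0}"
proof -
  let ?B = "(\<lambda>j. column j (diag_matrix d)) ` {i. d $ i \<noteq> 0}"
  have "columns (diag_matrix d) \<subseteq> span ?B"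
  proof
    fix x assume "x \<in> columns (diag_matrix d)"
    then obtain j where x: "x = column j (diag_matrix d)"
      by (auto simp: columns_def)
    show "x \<in> span ?B"
    proof (cases "d $ j = 0")
      case True
      then have "x = 0"
        by (simp add: x vec_eq_iff column_def diag_matrix_def)
      then show ?thesis by (simp add: span_zero)
    next
      case False
      then show ?thesis unfolding x by (intro span_base) auto
    qed
  qed
  then have "dim (columns (diag_matrix d)) \<le> card ?B"
    by (intro dim_le_card) auto
  also have "\<dots> \<le> card {i. d $ i \<noteq> 0}"
    by (rule card_image_le) simp
  finally show ?thesis
    by (simp add: column_rank_def)
qed

lemma spd_mat_1_plus_diag:
  fixes d :: "real^'n"
  assumes "\<And>j. 0 < 1 + d $ j"
  shows "spd (mat 1 + diag_matrix d)"
proof -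
  have M: "mat 1 + diag_matrix d = diag_matrix (\<chi> j. 1 + d $ j)"
    by (simp add: vec_eq_iff mat_def diag_matrix_def)
  have mult: "diag_matrix e *v x = (\<chi> j. e $ j * x $ j)" for e x :: "real^'n"
    by (simp add: vec_eq_iff matrix_vector_mult_def diag_matrix_def
        if_distrib [of "\<lambda>z. z * _"] sum.delta cong: if_cong)
  have "0 < x \<bullet> ((mat 1 + diag_matrix d) *v x)" if x: "x \<noteq> 0" for x :: "real^'n"
  proof -
    obtain j where "x $ j \<noteq> 0" using x by (metis vec_eq_iff zero_index)
    then have "0 < (\<Sum>j\<in>UNIV. (1 + d $ j) * (x $ j)\<^sup>2)"
      using assms by (intro sum_pos2 [of _ j]) (auto simp: less_imp_le)
    then show ?thesis
      by (simp add: M mult inner_vec_def power2_eq_square mult_ac)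
  qed
  moreover have "transpose (mat 1 + diag_matrix d) = mat 1 + diag_matrix d"
    unfolding M by (auto simp: vec_eq_iff transpose_def diag_matrix_def)
  ultimately show ?thesis by (simp add: spd_def)
qed

text \<open>
  Feasibility is phrased with a diagonal matrix indexed by the coordinates of the space, whereas
  the preconditioners of interest are sums over a set of eigenvalue positions. The coefficients
  are carried over along the enumeration and set to \<open>0\<close> elsewhere; the size of the set then
  bounds the rank.
\<close>

lemma spectral_modification_feasible:
  fixes S :: "real^'n^'n" and idx :: "nat \<Rightarrow> 'n"
  assumes inj: "inj_on idx I" and I: "finite I" "card I \<le> k"
    and c: "\<And>i. i \<in> I \<Longrightarrow> 0 < 1 + c i"
  shows "feasible S k
      (mat 1 + (\<Sum>i\<in>I. c i *\<^sub>R outer (column (idx i) S) (column (idx i) S)))"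
proof -
  define d :: "real^'n" where
    "d = (\<chi> j. if j \<in> idx ` I then c (inv_into I idx j) else 0)"
  have d: "d $ idx i = c i" if "i \<in> I" for i
    using that inj by (simp add: d_def)
  have d0: "d $ j = 0" if "j \<notin> idx ` I" for j
    using that by (simp add: d_def)
  have "S ** diag_matrix d ** transpose S
      = (\<Sum>j\<in>idx ` I. d $ j *\<^sub>R outer (column j S) (column j S))"
    unfolding diag_congruence_eq_sum_outer
    by (rule sum.mono_neutral_right) (auto simp: d0)
  also have "\<dots> = (\<Sum>i\<in>I. c i *\<^sub>R outer (column (idx i) S) (column (idx i) S))"
    using inj by (simp add: sum.reindex d)
  finally have F: "S ** diag_matrix d ** transpose S = \<dots>" .
  have "0 < 1 + d $ j" for j
    by (cases "j \<in> idx ` I") (auto simp: d d0 c)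
  then have "spd (mat 1 + diag_matrix d)"
    by (rule spd_mat_1_plus_diag)
  moreover have "rank (diag_matrix d) \<le> k"
  proof -
    have "card {j. d $ j \<noteq> 0} \<le> card (idx ` I)"
      using d0 I by (intro card_mono) auto
    also have "\<dots> \<le> card I"
      using I by (intro card_image_le)
    finally show ?thesis
      using rank_diag_matrix_le [of d] I by linarith
  qed
  ultimately show ?thesis
    unfolding feasible_def F [symmetric] by blast
qed

section \<open>Orthonormal eigenvectors\<close>

lemma orthogonal_matrix_column_inner:
  fixes S :: "real^'n^'n"
  assumes "orthogonal_matrix S"
  shows "column i S \<bullet> column j S = (if i = j then 1 else 0)"
proof -
  have "(transpose S ** S) $ i $ j = (mat 1 :: real^'n^'n) $ i $ j"
    using assms by (simp add: orthogonal_matrix_def)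
  then show ?thesis
    by (simp add: matrix_matrix_mult_def transpose_def mat_def column_def inner_vec_def)
qed

text \<open>
  Completeness of the columns is the relation \<open>S S\<^sup>T = I\<close>, read as a sum of rank-one projections.
\<close>

lemma orthogonal_matrix_expansion:
  fixes S :: "real^'n^'n"
  assumes "orthogonal_matrix S"
  shows "x = (\<Sum>j\<in>UNIV. (column j S \<bullet> x) *\<^sub>R column j S)"
proof -
  have one: "diag_matrix (\<chi> j. 1) = (mat 1 :: real^'n^'n)"
    by (simp add: diag_matrix_def mat_def vec_eq_iff)
  have "S ** diag_matrix (\<chi> j. 1) ** transpose S = mat 1"
    using assms by (simp add: one orthogonal_matrix_def)
  then have "(\<Sum>j\<in>UNIV. 1 *\<^sub>R outer (column j S) (column j S)) *v x = x"
    by (simp add: diag_congruence_eq_sum_outer)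
  then show ?thesis
    unfolding sum_scaled_outer_mult_vec by simp
qed

lemma orthogonal_spectral_eigenvector:
  fixes S :: "real^'n^'n"
  assumes "orthogonal_matrix S"
  shows "(S ** diag_matrix d ** transpose S) *v column j S = d $ j *\<^sub>R column j S"
  by (simp add: diag_congruence_eq_sum_outer sum_scaled_outer_mult_vec
      orthogonal_matrix_column_inner [OF assms] if_distrib [of "\<lambda>z. _ * z"]
      if_distrib [of "\<lambda>z. z *\<^sub>R _"] sum.delta cong: if_cong)

lemma inner_sum_orthonormal:
  fixes s :: "nat \<Rightarrow> 'a::real_inner"
  assumes orth: "\<And>i j. i \<in> I \<union> J \<Longrightarrow> j \<in> I \<union> J \<Longrightarrow> s i \<bullet> s j = (if i = j then 1 else 0)"
    and fin: "finite I" "finite J"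
  shows "(\<Sum>i\<in>I. f i *\<^sub>R s i) \<bullet> (\<Sum>j\<in>J. g j *\<^sub>R s j) = (\<Sum>i\<in>I \<inter> J. f i * g i)"
proof -
  have "(\<Sum>i\<in>I. f i *\<^sub>R s i) \<bullet> (\<Sum>j\<in>J. g j *\<^sub>R s j)
      = (\<Sum>i\<in>I. \<Sum>j\<in>J. if i = j then f i * g j else 0)"
    unfolding inner_sum_left unfolding inner_sum_right
    by (intro sum.cong refl) (auto simp: orth)
  also have "\<dots> = (\<Sum>i\<in>I. if i \<in> J then f i * g i else 0)"
    using fin by (intro sum.cong refl) (simp add: sum.delta')
  also have "\<dots> = (\<Sum>i\<in>I \<inter> J. f i * g i)"
    using fin by (simp add: sum.inter_restrict)
  finally show ?thesis .
qed

section \<open>The weighted least-squares residual polynomial of degree one\<close>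

lemma P1_zero_eq: "P1_zero = range (\<lambda>c. [:1, c:])"
proof -
  have "\<exists>c. p = [:1, c:]" if "degree p \<le> 1" "poly p 0 = 1" for p :: "real poly"
  proof -
    obtain a q where p: "p = pCons a q" by (cases p)
    with that have "a = 1" "degree q = 0" by (auto split: if_splits)
    then show ?thesis using p by (metis degree_eq_zeroE)
  qed
  then show ?thesis by (auto simp: P1_zero_def)
qed

text \<open>
  On \<open>P1_zero\<close> the only freedom is the slope, and the objective is a quadratic in it with
  leading coefficient \<open>\<Sum> w\<^sub>i * \<lambda>\<^sub>i\<^sup>2\<close>. Completing the square yields the minimiser, and positivity
  of that coefficient yields uniqueness.
\<close>

lemma weighted_square_P1_zero_argmin:
  fixes w lam :: "'i \<Rightarrow> real" and I :: "'i set"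
  defines "f \<equiv> \<lambda>p. \<Sum>i\<in>I. w i * (poly p (lam i))\<^sup>2"
    and "c \<equiv> - (\<Sum>i\<in>I. w i * lam i) / (\<Sum>i\<in>I. w i * (lam i)\<^sup>2)"
  assumes Q: "0 < (\<Sum>i\<in>I. w i * (lam i)\<^sup>2)"
  shows "{p. is_arg_min f (\<lambda>p. p \<in> P1_zero) p} = {[:1, c:]}"
proof -
  let ?Q = "\<Sum>i\<in>I. w i * (lam i)\<^sup>2" and ?B = "\<Sum>i\<in>I. w i * lam i"
  have f: "f [:1, a:] = sum w I + 2 * a * ?B + a\<^sup>2 * ?Q" for a
    by (simp add: f_def sum_distrib_left sum.distrib [symmetric] power2_eq_square algebra_simps)
  have "?B = - c * ?Q" using Q by (simp add: c_def)
  then have excess: "f [:1, a:] - f [:1, c:] = (a - c)\<^sup>2 * ?Q" for a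
    unfolding f by (simp add: power2_eq_square algebra_simps)
  have le: "f [:1, c:] \<le> f [:1, a:]" for a
    using excess [of a] Q by (smt (verit) mult_nonneg_nonneg zero_le_power2)
  have lt: "f [:1, c:] < f [:1, a:]" if "a \<noteq> c" for a
    using excess [of a] Q that by (smt (verit) mult_pos_pos zero_less_power2)
  have "is_arg_min f (\<lambda>p. p \<in> P1_zero) p \<longleftrightarrow> p = [:1, c:]" for p
  proof
    assume p: "is_arg_min f (\<lambda>p. p \<in> P1_zero) p"
    then obtain a where a: "p = [:1, a:]"
      unfolding is_arg_min_def P1_zero_eq by blast
    have "\<not> f [:1, c:] < f p"
      using p by (simp add: is_arg_min_def P1_zero_eq)
    then have "a = c" using lt [of a] unfolding a by argo
    then show "p = [:1, c:]" by (simp add: a)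
  next
    assume "p = [:1, c:]"
    moreover have "\<not> f q < f [:1, c:]" if "q \<in> P1_zero" for q
    proof -
      from that obtain a where "q = [:1, a:]" unfolding P1_zero_eq by blast
      then show ?thesis using le [of a] by (simp only: not_less)
    qed
    ultimately show "is_arg_min f (\<lambda>p. p \<in> P1_zero) p"
      by (auto simp only: is_arg_min_def P1_zero_eq)
  qed
  then show ?thesis by simp
qed

section \<open>First iterates\<close>

lemma pcg_iterate_1:
  "pcg_iterate A F b x0 (Suc 0) =
     (let r = b - A *v x0; z = F *v r in x0 + ((r \<bullet> z) / ((A *v z) \<bullet> z)) *\<^sub>R z)"
  by (simp add: pcg_iterate_def Let_def)

text \<open>
  A preconditioner that inverts \<open>A\<close> on the initial residual makes the first search direction
  equal to the initial error. The step length is then \<open>1\<close>; if the error is already \<open>0\<close>,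
  the step length is \<open>0 / 0 = 0\<close> and the iterate stays at the solution.
\<close>

lemma pcg_iterate_1_exact:
  fixes A F :: "real^'n^'n"
  assumes A: "spd A" and inverse_on_residual: "A *v (F *v (b - A *v x0)) = b - A *v x0"
  shows "pcg_iterate A F b x0 1 = matrix_inv A *v b"
proof -
  define r where "r = b - A *v x0"
  define z where "z = F *v r"
  have Az: "A *v z = r" using inverse_on_residual by (simp add: r_def z_def)
  have x1: "pcg_iterate A F b x0 1 = x0 + z"
  proof (cases "z = 0")
    case True
    then show ?thesis by (simp add: pcg_iterate_1 Let_def r_def [symmetric] z_def [symmetric])
  next
    case False
    then have "r \<bullet> z \<noteq> 0"
      using A Az by (auto simp: spd_def inner_commute dest: less_imp_neq)
    then show ?thesis
      by (simp add: pcg_iterate_1 Let_def r_def [symmetric] z_def [symmetric] Az)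
  qed
  have "\<forall>x. A *v x = 0 \<longrightarrow> x = 0"
    using A by (metis spd_def inner_zero_right less_irrefl)
  then have "invertible A"
    by (metis matrix_left_invertible_ker invertible_left_inverse)
  then have "matrix_inv A ** A = mat 1"
    unfolding invertible_def matrix_inv_def by (rule someI2_ex) simp
  then have "matrix_inv A *v (A *v (x0 + z)) = x0 + z"
    by (simp add: matrix_vector_mul_assoc)
  moreover have "A *v (x0 + z) = b"
    by (simp add: matrix_vector_right_distrib Az r_def)
  ultimately show ?thesis unfolding x1 by simp
qed

text \<open>
  The step length of PCG is the quotient of \<open>r \<bullet> z\<close> and \<open>A z \<bullet> z\<close>. For the residual
  \<open>r = y + g\<close> and the direction \<open>z = y + \<theta> v\<close>, thought of with \<open>g = A v\<close>,
  orthogonality removes the mixed terms, and both the \<open>y\<close>-part and the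
  \<open>v\<close>-part of the denominator are \<open>\<theta>\<close> times the corresponding part of the numerator: the
  former because \<open>\<theta>\<close> is the Rayleigh quotient of \<open>y\<close>, the latter by the scaling of \<open>v\<close>.
  The vector \<open>Ay\<close> stands for the image of \<open>y\<close> under \<open>A\<close>.
\<close>

lemma split_residual_step_length:
  fixes y g v :: "'a::real_inner"
  assumes \<theta>: "0 < \<theta>" and y: "y \<noteq> 0" and gv: "0 \<le> g \<bullet> v"
    and orth: "y \<bullet> v = 0" "y \<bullet> g = 0" "Ay \<bullet> v = 0"
    and Ay: "Ay \<bullet> y = \<theta> * (y \<bullet> y)"
  shows "((y + g) \<bullet> (y + \<theta> *\<^sub>R v)) / ((Ay + \<theta> *\<^sub>R g) \<bullet> (y + \<theta> *\<^sub>R v)) = 1 / \<theta>"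
proof -
  let ?\<rho> = "y \<bullet> y + \<theta> * (g \<bullet> v)"
  have "0 < ?\<rho>" using \<theta> y gv by (simp add: add_pos_nonneg)
  moreover have "(y + g) \<bullet> (y + \<theta> *\<^sub>R v) = ?\<rho>"
    using orth by (simp add: inner_add inner_commute)
  moreover have "(Ay + \<theta> *\<^sub>R g) \<bullet> (y + \<theta> *\<^sub>R v) = \<theta> * ?\<rho>"
    using orth Ay by (simp add: inner_add inner_commute algebra_simps)
  ultimately show ?thesis using \<theta> by simp
qed

theorem theorem4p3:
  fixes A S P :: "real^'n^'n"
    and b x0 xstar r0 z1 x1D \<Lambda> :: "real^'n"
    and idx :: "nat \<Rightarrow> 'n"
    and lam eta :: "nat \<Rightarrow> real"
    and s :: "nat \<Rightarrow> real^'n"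
    and n k j0 l :: nat
    and pik cpik :: "nat set"
  assumes n: "n = CARD('n)" and k: "1 < k" "k < n"
    and idx: "bij_betw idx {1..n} UNIV"
    and A: "spd A"
    and S: "orthogonal_matrix S"
    and spectral: "A = S ** diag_matrix \<Lambda> ** transpose S"
    and lam: "lam = (\<lambda>i. \<Lambda> $ idx i)"
    and s: "s = (\<lambda>i. column (idx i) S)"
    and ordered: "\<And>i j. 1 \<le> i \<Longrightarrow> i \<le> j \<Longrightarrow> j \<le> n \<Longrightarrow> lam j \<le> lam i"
    and pos: "0 < lam n"
    and xstar: "xstar = matrix_inv A *v b"
    and r0: "r0 = b - A *v x0"
    and eta: "eta = (\<lambda>i. s i \<bullet> r0)"
    and j0: "is_arg_min (\<lambda>j. lam j / lam (n - k + j - 1)) (\<lambda>j. 1 \<le> j \<and> j \<le> k + 1) j0"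
    and cpik: "cpik = {j0..n - k + j0 - 1}"
    and pik: "pik = {1..n} - cpik"
    and P: "P = mat 1 - (\<Sum>i\<in>pik. outer (s i) (s i))"
    and z1: "z1 = cg_iterate (P ** A) (P *v b) x0 1"
    and x1D: "x1D = (\<Sum>i\<in>pik. (1 / lam i) *\<^sub>R (outer (s i) (s i) *v b)) + P *v z1"
    and l: "1 \<le> l"
    and not_reached: "\<And>F. feasible S k F \<Longrightarrow>
          pcg_defined A F b x0 l \<and> (\<forall>j\<le>l. pcg_iterate A F b x0 j \<noteq> xstar)"
  shows "\<exists>p1D \<theta>1 F.
      {p. is_arg_min (\<lambda>p. \<Sum>i\<in>cpik. (eta i)\<^sup>2 / lam i * (poly p (lam i))\<^sup>2) (\<lambda>p. p \<in> P1_zero) p} = {p1D}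
    \<and> {t. poly p1D t = 0} = {\<theta>1}
    \<and> F = mat 1 + (\<Sum>i\<in>pik. (\<theta>1 / lam i - 1) *\<^sub>R outer (s i) (s i))
    \<and> (energy_norm A (xstar - pcg_iterate A F b x0 1))\<^sup>2 = (energy_norm A (xstar - x1D))\<^sup>2"
proof -
  have j0_range: "1 \<le> j0" "j0 \<le> k + 1"
    using j0 by (auto simp: is_arg_min_def)
  have cpik_sub: "cpik \<subseteq> {1..n}" and pik_sub: "pik \<subseteq> {1..n}"
    using j0_range k by (auto simp: cpik pik)
  have fin: "finite pik" "finite cpik" by (simp_all add: cpik pik)
  have disj: "pik \<inter> cpik = {}" "cpik \<inter> pik = {}" and un: "pik \<union> cpik = {1..n}"
    using cpik_sub by (auto simp: pik)
  have card_pik: "card pik = k"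
    using cpik_sub k j0_range by (simp add: pik card_Diff_subset fin) (simp add: cpik)
  have lam_pos: "0 < lam i" if "i \<in> {1..n}" for i
    using that pos ordered [of i n] by fastforce
  have inj: "inj_on idx {1..n}" using idx by (rule bij_betw_imp_inj_on)
  have orth: "s i \<bullet> s j = (if i = j then 1 else 0)" if "i \<in> {1..n}" "j \<in> {1..n}" for i j
    using that by (simp add: s orthogonal_matrix_column_inner [OF S] inj_on_eq_iff [OF inj])
  have inner_expansion: "(\<Sum>i\<in>I. f i *\<^sub>R s i) \<bullet> (\<Sum>i\<in>J. g i *\<^sub>R s i) = (\<Sum>i\<in>I \<inter> J. f i * g i)"
    if "I \<subseteq> {1..n}" "J \<subseteq> {1..n}" for I J f g
    using that by (intro inner_sum_orthonormal orth) (auto intro: finite_subset)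
  have expansion: "x = (\<Sum>i\<in>{1..n}. (s i \<bullet> x) *\<^sub>R s i)" for x
  proof -
    have "x = (\<Sum>j\<in>UNIV. (column j S \<bullet> x) *\<^sub>R column j S)"
      by (rule orthogonal_matrix_expansion [OF S])
    also have "\<dots> = (\<Sum>i\<in>{1..n}. (s i \<bullet> x) *\<^sub>R s i)"
      unfolding s by (rule sum.reindex_bij_betw [OF idx, symmetric])
    finally show ?thesis .
  qed
  have A_s: "A *v s i = lam i *\<^sub>R s i" for i
    by (simp add: s lam spectral orthogonal_spectral_eigenvector [OF S])
  have A_sum: "A *v (\<Sum>i\<in>I. f i *\<^sub>R s i) = (\<Sum>i\<in>I. (f i * lam i) *\<^sub>R s i)" for I f
    by (simp add: linear_sum [OF matrix_vector_mul_linear] matrix_vector_mult_scaleR A_s)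
  have s_A: "s i \<bullet> (A *v x) = lam i * (s i \<bullet> x)" for i x
  proof -
    have "s i \<bullet> (A *v x) = (A *v s i) \<bullet> x"
      using A by (metis spd_def dot_lmul_matrix vector_transpose_matrix inner_commute)
    then show ?thesis by (simp add: A_s)
  qed

  \<comment> \<open>The two parts \<open>y\<close> and \<open>g\<close> of the residual, and the part \<open>v\<close> of the initial error that
      produces \<open>g\<close>.\<close>
  define y where "y = (\<Sum>i\<in>cpik. eta i *\<^sub>R s i)"
  define g where "g = (\<Sum>i\<in>pik. eta i *\<^sub>R s i)"
  define v where "v = (\<Sum>i\<in>pik. (eta i / lam i) *\<^sub>R s i)"
  define F\<theta> where "F\<theta> \<theta> = mat 1 + (\<Sum>i\<in>pik. (\<theta> / lam i - 1) *\<^sub>R outer (s i) (s i))" for \<theta>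
  have r0_split: "r0 = y + g"
  proof -
    have "r0 = (\<Sum>i\<in>pik \<union> cpik. eta i *\<^sub>R s i)"
      unfolding un eta by (rule expansion)
    also have "\<dots> = g + y"
      unfolding g_def y_def using fin disj by (intro sum.union_disjoint) auto
    finally show ?thesis by (simp add: add.commute)
  qed
  have Av: "A *v v = g"
    unfolding v_def A_sum g_def using pik_sub lam_pos
    by (intro sum.cong refl) (auto simp: less_imp_neq [THEN not_sym] subset_iff)
  have F_r0: "F\<theta> \<theta> *v r0 = y + \<theta> *\<^sub>R v" for \<theta>
  proof -
    have "F\<theta> \<theta> *v r0 = r0 + (\<Sum>i\<in>pik. (\<theta> / lam i * eta i) *\<^sub>R s i - eta i *\<^sub>R s i)"
      unfolding F\<theta>_def matrix_vector_mult_add_rdistrib sum_scaled_outer_mult_vec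
      by (simp add: eta left_diff_distrib scaleR_diff_left)
    also have "\<dots> = r0 + \<theta> *\<^sub>R v - g"
      by (simp add: sum_subtractf v_def g_def scaleR_sum_right)
    finally show ?thesis by (simp add: r0_split)
  qed
  have P_mult: "P *v x = x - (\<Sum>i\<in>pik. (s i \<bullet> x) *\<^sub>R s i)" for x
    using sum_scaled_outer_mult_vec [of "\<lambda>_. 1" s pik x]
    by (simp add: P matrix_vector_mult_diff_rdistrib)
  have P_r0: "P *v r0 = y"
  proof -
    have "P *v r0 = r0 - g" unfolding P_mult g_def eta ..
    then show ?thesis by (simp add: r0_split)
  qed

  have y_nz: "y \<noteq> 0"
  proof
    assume "y = 0"
    have "feasible S k (F\<theta> 1)"
      unfolding F\<theta>_def s using fin card_pik pik_sub lam_pos inj_on_subset [OF inj pik_sub]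
      by (intro spectral_modification_feasible) (auto simp: subset_iff)
    then have "pcg_iterate A (F\<theta> 1) b x0 1 \<noteq> xstar"
      using not_reached l by blast
    moreover have "pcg_iterate A (F\<theta> 1) b x0 1 = xstar"
      unfolding xstar using A
      by (rule pcg_iterate_1_exact) (use F_r0 [of 1] Av r0_split \<open>y = 0\<close> in \<open>simp add: r0\<close>)
    ultimately show False by simp
  qed

  \<comment> \<open>The Rayleigh quotient of \<open>y\<close>, written in eigencoordinates.\<close>
  define \<theta> where "\<theta> = (\<Sum>i\<in>cpik. (eta i)\<^sup>2 * lam i) / (\<Sum>i\<in>cpik. (eta i)\<^sup>2)"
  have yy: "y \<bullet> y = (\<Sum>i\<in>cpik. (eta i)\<^sup>2)"
    unfolding y_def inner_expansion [OF cpik_sub cpik_sub] by (simp add: power2_eq_square)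
  have Ayy: "(A *v y) \<bullet> y = (\<Sum>i\<in>cpik. (eta i)\<^sup>2 * lam i)"
    unfolding y_def A_sum inner_expansion [OF cpik_sub cpik_sub]
    by (simp add: power2_eq_square mult_ac)
  have yy_pos: "0 < (\<Sum>i\<in>cpik. (eta i)\<^sup>2)"
    using y_nz by (simp add: yy [symmetric])
  have Ayy_pos: "0 < (\<Sum>i\<in>cpik. (eta i)\<^sup>2 * lam i)"
    using A y_nz by (simp add: Ayy [symmetric] spd_def inner_commute)
  have \<theta>_pos: "0 < \<theta>" using yy_pos Ayy_pos by (simp add: \<theta>_def)
  have Ayy_\<theta>: "(A *v y) \<bullet> y = \<theta> * (y \<bullet> y)"
    using yy_pos by (simp add: yy Ayy \<theta>_def)

  have argmin: "{p. is_arg_min (\<lambda>p. \<Sum>i\<in>cpik. (eta i)\<^sup>2 / lam i * (poly p (lam i))\<^sup>2)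
      (\<lambda>p. p \<in> P1_zero) p} = {[:1, - (1 / \<theta>):]}"
  proof -
    have nz: "lam i \<noteq> 0" if "i \<in> cpik" for i
      using that lam_pos cpik_sub by fastforce
    have B: "(\<Sum>i\<in>cpik. (eta i)\<^sup>2 / lam i * lam i) = (\<Sum>i\<in>cpik. (eta i)\<^sup>2)"
      by (intro sum.cong refl) (simp add: nz)
    have Q: "(\<Sum>i\<in>cpik. (eta i)\<^sup>2 / lam i * (lam i)\<^sup>2) = (\<Sum>i\<in>cpik. (eta i)\<^sup>2 * lam i)"
      by (intro sum.cong refl) (simp add: nz power2_eq_square)
    show ?thesis
      using weighted_square_P1_zero_argmin
        [where I = cpik and w = "\<lambda>i. (eta i)\<^sup>2 / lam i" and lam = lam,
          unfolded B Q, OF Ayy_pos]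
      by (simp add: \<theta>_def)
  qed
  have root: "{t. poly [:1, - (1 / \<theta>):] t = 0} = {\<theta>}"
    using \<theta>_pos by (auto simp: field_simps)

  have pcg: "pcg_iterate A (F\<theta> \<theta>) b x0 1 = x0 + (1 / \<theta>) *\<^sub>R y + v"
  proof -
    have gv: "0 \<le> g \<bullet> v"
      unfolding Av [symmetric] using A
      by (cases "v = 0") (auto simp: spd_def inner_commute intro: less_imp_le)
    have "y \<bullet> v = 0" "y \<bullet> g = 0" "(A *v y) \<bullet> v = 0"
      unfolding y_def v_def g_def A_sum inner_expansion [OF cpik_sub pik_sub] by (simp_all add: disj)
    note step = split_residual_step_length [OF \<theta>_pos y_nz gv this Ayy_\<theta>]
    have "pcg_iterate A (F\<theta> \<theta>) b x0 1 = x0 + (1 / \<theta>) *\<^sub>R (y + \<theta> *\<^sub>R v)"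
      using step F_r0 [of \<theta>] Av r0_split
      by (simp add: pcg_iterate_1 r0 [symmetric] matrix_vector_right_distrib
          matrix_vector_mult_scaleR)
    then show ?thesis using \<theta>_pos by (simp add: scaleR_add_right)
  qed

  have s_y: "s i \<bullet> y = 0" if "i \<in> pik" for i
    using that pik_sub cpik_sub disj unfolding y_def inner_sum_right
    by (intro sum.neutral ballI) (auto simp: orth subset_iff)
  have z1_eq: "z1 = x0 + (1 / \<theta>) *\<^sub>R y"
  proof -
    \<comment> \<open>The residual of the deflated system at \<open>x0\<close> is \<open>y\<close>, and \<open>P\<close> fixes \<open>A y\<close>
        because the span of the deflated eigenvectors and its complement are invariant under \<open>A\<close>.\<close>
    have res: "P *v b - P ** A *v x0 = y"
      by (simp add: matrix_vector_mul_assoc [symmetric] matrix_vector_mult_diff_distrib [symmetric]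
          r0 [symmetric] P_r0)
    have "(\<Sum>i\<in>pik. (s i \<bullet> (A *v y)) *\<^sub>R s i) = 0"
      by (intro sum.neutral ballI) (simp add: s_A s_y)
    then have "P ** A *v y = A *v y"
      by (simp add: matrix_vector_mul_assoc [symmetric] P_mult)
    moreover have "(y \<bullet> y) / ((A *v y) \<bullet> y) = 1 / \<theta>"
      using y_nz by (simp add: Ayy_\<theta>)
    ultimately show ?thesis
      by (simp add: z1 cg_iterate_def pcg_iterate_1 res)
  qed

  have "x1D = x0 + (1 / \<theta>) *\<^sub>R y + v"
  proof -
    have Py: "P *v y = y"
      by (simp add: P_mult s_y)
    \<comment> \<open>The projection \<open>P\<close> removes the deflated components of \<open>x0\<close>; together with the direct
        solution in these components this amounts to the correction \<open>v\<close>.\<close>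
    have "(\<Sum>i\<in>pik. (1 / lam i) *\<^sub>R (outer (s i) (s i) *v b)) - (\<Sum>i\<in>pik. (s i \<bullet> x0) *\<^sub>R s i) = v"
      unfolding v_def sum_subtractf [symmetric]
    proof (intro sum.cong refl)
      fix i assume "i \<in> pik"
      then have "lam i \<noteq> 0" using lam_pos pik_sub by fastforce
      moreover have "eta i = s i \<bullet> b - lam i * (s i \<bullet> x0)"
        by (simp add: eta r0 inner_diff_right s_A)
      ultimately show "(1 / lam i) *\<^sub>R (outer (s i) (s i) *v b) - (s i \<bullet> x0) *\<^sub>R s i
          = (eta i / lam i) *\<^sub>R s i"
        by (simp add: outer_mult_vec diff_divide_distrib scaleR_diff_left)
    qed
    moreover have "P *v z1 = x0 - (\<Sum>i\<in>pik. (s i \<bullet> x0) *\<^sub>R s i) + (1 / \<theta>) *\<^sub>R y"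
      by (simp add: z1_eq matrix_vector_right_distrib matrix_vector_mult_scaleR Py P_mult [of x0])
    ultimately show ?thesis by (simp add: x1D algebra_simps)
  qed
  with pcg have "pcg_iterate A (F\<theta> \<theta>) b x0 1 = x1D" by simp
  then show ?thesis
    using argmin root
    by (intro exI [of _ "[:1, - (1 / \<theta>):]"] exI [of _ \<theta>] exI [of _ "F\<theta> \<theta>"] conjI)
      (simp_all only: F\<theta>_def)
qed

end
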